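(* Let $n\geq 2$ be a natural number. Let $\varphi$ be any formula of the language $\mathsf L^\forall_\Diamond$ that defines, on the class of all graphs, the property of not being $n$-colourable; i.e., for every graph $\mathcal G$, $\varphi$ is valid on $\mathcal G$ if and only if $\mathcal G$ is not $n$-colourable. Then $\varphi$ contains at least $\lceil \log_2(n)\rceil$ distinct propositional variables, contains at least one occurrence of $\exists$, and has length at least $n$.
   Context: Fix a countably infinite set of propositional variables $P=\{p_1,p_2,\ldots\}$. The language $\mathsf L^\forall_\Diamond$ consists of formulas in negation normal form: the atomic formulas are the literals $p$ and $\overline p$ (for $p\in P$), $\bot$ and $\top$, and formulas are closed under the binary connectives $\vee,\wedge$ and the unary connectives $\Diamond,\Box,\exists,\forall$; $\neg\varphi$ and $\varphi\to\psi$ are abbreviations defined via De Morgan's rules. A frame is a pair $(W,R)$ with $W$ nonempty and $R\subseteq W\times W$; a model adds a valuation $V: W\to 2^P$. Semantics is the standard Kripke semantics, with $\overline p$ true at $w$ iff $p\notin V(w)$, $\Diamond,\Box$ quantifying over $R$-successors, and $\exists,\forall$ quantifying over all points of $W$ (universal modalities). A formula is valid on a frame if it is true at every point under every valuation. A graph is a frame whose relation $R$ is symmetric (loops are allowed). A graph $(W,R)$ is $n$-colourable if there is a map $c:W\to\{1,\ldots,n\}$ with $c(w)\neq c(v)$ whenever $wRv$ (in particular a vertex with a loop makes the graph non-$n$-colourable). The length of a formula is the number of nodes of its syntax tree (leaves included). *)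

theory Defs
  imports Complex_Main
begin

text \<open>
  Formulas in negation normal form.  The propositional variables \<open>p\<^sub>1, p\<^sub>2, \<dots>\<close> are indexed by
  \<^typ>\<open>nat\<close>; \<open>NVar p\<close> is the literal \<open>p\<close> with a bar, an atomic formula of its own.
  \<open>Exists\<close> and \<open>Forall\<close> are the universal modalities.
\<close>

datatype fm =
    Var nat
  | NVar nat
  | Bot
  | Top
  | Or fm fm
  | And fm fm
  | Dia fm
  | Box fm
  | Exists fm
  | Forall fm

primrec vars :: "fm \<Rightarrow> nat set" where
  "vars (Var p) = {p}"
| "vars (NVar p) = {p}"
| "vars Bot = {}"
| "vars Top = {}"
| "vars (Or \<phi> \<psi>) = vars \<phi> \<union> vars \<psi>"
| "vars (And \<phi> \<psi>) = vars \<phi> \<union> vars \<psi>"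
| "vars (Dia \<phi>) = vars \<phi>"
| "vars (Box \<phi>) = vars \<phi>"
| "vars (Exists \<phi>) = vars \<phi>"
| "vars (Forall \<phi>) = vars \<phi>"

primrec exists_count :: "fm \<Rightarrow> nat" where
  "exists_count (Var p) = 0"
| "exists_count (NVar p) = 0"
| "exists_count Bot = 0"
| "exists_count Top = 0"
| "exists_count (Or \<phi> \<psi>) = exists_count \<phi> + exists_count \<psi>"
| "exists_count (And \<phi> \<psi>) = exists_count \<phi> + exists_count \<psi>"
| "exists_count (Dia \<phi>) = exists_count \<phi>"
| "exists_count (Box \<phi>) = exists_count \<phi>"
| "exists_count (Exists \<phi>) = exists_count \<phi> + 1"
| "exists_count (Forall \<phi>) = exists_count \<phi>"

text \<open>
  Number of nodes of the syntax tree, leaves included; a literal is a single leaf.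
\<close>

primrec fm_length :: "fm \<Rightarrow> nat" where
  "fm_length (Var p) = 1"
| "fm_length (NVar p) = 1"
| "fm_length Bot = 1"
| "fm_length Top = 1"
| "fm_length (Or \<phi> \<psi>) = fm_length \<phi> + fm_length \<psi> + 1"
| "fm_length (And \<phi> \<psi>) = fm_length \<phi> + fm_length \<psi> + 1"
| "fm_length (Dia \<phi>) = fm_length \<phi> + 1"
| "fm_length (Box \<phi>) = fm_length \<phi> + 1"
| "fm_length (Exists \<phi>) = fm_length \<phi> + 1"
| "fm_length (Forall \<phi>) = fm_length \<phi> + 1"

definition frame :: "'w set \<Rightarrow> 'w rel \<Rightarrow> bool" where
  "frame W R \<longleftrightarrow> W \<noteq> {} \<and> R \<subseteq> W \<times> W"

text \<open>
  A valuation is a total function on \<open>'w\<close>; on a frame \<open>(W, R)\<close> only its values on \<open>W\<close> are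
  consulted at points of \<open>W\<close>.
\<close>

primrec sat :: "'w set \<Rightarrow> 'w rel \<Rightarrow> ('w \<Rightarrow> nat set) \<Rightarrow> 'w \<Rightarrow> fm \<Rightarrow> bool" where
  "sat W R V w (Var p) \<longleftrightarrow> p \<in> V w"
| "sat W R V w (NVar p) \<longleftrightarrow> p \<notin> V w"
| "sat W R V w Bot \<longleftrightarrow> False"
| "sat W R V w Top \<longleftrightarrow> True"
| "sat W R V w (Or \<phi> \<psi>) \<longleftrightarrow> sat W R V w \<phi> \<or> sat W R V w \<psi>"
| "sat W R V w (And \<phi> \<psi>) \<longleftrightarrow> sat W R V w \<phi> \<and> sat W R V w \<psi>"
| "sat W R V w (Dia \<phi>) \<longleftrightarrow> (\<exists>v. (w, v) \<in> R \<and> sat W R V v \<phi>)"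
| "sat W R V w (Box \<phi>) \<longleftrightarrow> (\<forall>v. (w, v) \<in> R \<longrightarrow> sat W R V v \<phi>)"
| "sat W R V w (Exists \<phi>) \<longleftrightarrow> (\<exists>v\<in>W. sat W R V v \<phi>)"
| "sat W R V w (Forall \<phi>) \<longleftrightarrow> (\<forall>v\<in>W. sat W R V v \<phi>)"

definition valid_on :: "'w set \<Rightarrow> 'w rel \<Rightarrow> fm \<Rightarrow> bool" where
  "valid_on W R \<phi> \<longleftrightarrow> (\<forall>V. \<forall>w\<in>W. sat W R V w \<phi>)"

definition graph :: "'w set \<Rightarrow> 'w rel \<Rightarrow> bool" where
  "graph W R \<longleftrightarrow> frame W R \<and> sym R"

definition colourable :: "nat \<Rightarrow> 'w set \<Rightarrow> 'w rel \<Rightarrow> bool" where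
  "colourable n W R \<longleftrightarrow>
     (\<exists>c :: 'w \<Rightarrow> nat. (\<forall>w\<in>W. c w \<in> {1..n}) \<and> (\<forall>w v. (w, v) \<in> R \<longrightarrow> c w \<noteq> c v))"

text \<open>
  Definability on the class of all graphs whose vertices are drawn from the type \<open>'w\<close>.  HOL
  cannot quantify over types inside a formula; the vertex set \<open>W\<close> ranges over all nonempty
  subsets of \<open>'w\<close>, so an infinite \<open>'w\<close> yields a copy of every finite (and countable) graph.
  A formula that defines a property on all graphs in particular defines it on these.
\<close>

definition defines_on_graphs :: "fm \<Rightarrow> ('w set \<Rightarrow> 'w rel \<Rightarrow> bool) \<Rightarrow> bool" where
  "defines_on_graphs \<phi> P \<longleftrightarrow> (\<forall>W R. graph W R \<longrightarrow> (valid_on W R \<phi> \<longleftrightarrow> P W R))"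

end

theory Submission
  imports Defs
begin

text \<open>
  On a complete graph with \<open>n\<close> vertices \<open>\<phi>\<close> is refuted by some valuation.  If at some vertex \<open>u\<close>
  a loop could be added without changing the truth of subformulas, \<open>\<phi>\<close> would fail on a graph with a
  loop.  A loop at \<open>u\<close> changes nothing unless \<open>\<phi>\<close> has a subformula \<open>Dia \<psi>\<close> with \<open>\<psi>\<close> true
  exactly at \<open>u\<close>, or \<open>Box \<psi>\<close> with \<open>\<psi>\<close> false exactly at \<open>u\<close>.  Hence each of the \<open>n\<close> vertices
  is singled out by a modal subformula of its own, so \<open>\<phi>\<close> is long, and no two vertices satisfy the
  same variables of \<open>\<phi>\<close>, so \<open>\<phi>\<close> has at least \<open>log 2 n\<close> variables.  A formula without \<open>Exists\<close> that
  is refuted on a graph stays refuted when an isolated looped point is added.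
\<close>

definition complete_rel :: "'w set \<Rightarrow> 'w rel" where
  "complete_rel W = {(u, v). u \<in> W \<and> v \<in> W \<and> u \<noteq> v}"

text \<open>Each set \<open>{u. A = {u}}\<close> has at most one element. So every
  \<open>Dia\<close> or \<open>Box\<close> node contributes at most one vertex, and all other nodes
  contribute none.\<close>

primrec loop_critical :: "'w set \<Rightarrow> 'w rel \<Rightarrow> ('w \<Rightarrow> nat set) \<Rightarrow> fm \<Rightarrow> 'w set" where
  "loop_critical W R V (Var p) = {}"
| "loop_critical W R V (NVar p) = {}"
| "loop_critical W R V Bot = {}"
| "loop_critical W R V Top = {}"
| "loop_critical W R V (Or \<phi> \<psi>) = loop_critical W R V \<phi> \<union> loop_critical W R V \<psi>"
| "loop_critical W R V (And \<phi> \<psi>) = loop_critical W R V \<phi> \<union> loop_critical W R V \<psi>"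
| "loop_critical W R V (Dia \<phi>) = loop_critical W R V \<phi> \<union> {u. {w \<in> W. sat W R V w \<phi>} = {u}}"
| "loop_critical W R V (Box \<phi>) = loop_critical W R V \<phi> \<union> {u. {w \<in> W. \<not> sat W R V w \<phi>} = {u}}"
| "loop_critical W R V (Exists \<phi>) = loop_critical W R V \<phi>"
| "loop_critical W R V (Forall \<phi>) = loop_critical W R V \<phi>"

lemma finite_card_singleton_eq: "finite {u. A = {u}} \<and> card {u. A = {u}} \<le> 1"
proof (cases "\<exists>a. A = {a}")
  case True
  then obtain a where "A = {a}" by blast
  then have "{u. A = {u}} = {a}" by auto
  then show ?thesis by simp
next
  case False
  then show ?thesis by simp
qed

lemma finite_card_loop_critical:
  "finite (loop_critical W R V \<phi>) \<and> card (loop_critical W R V \<phi>) \<le> fm_length \<phi>"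
proof (induction \<phi>)
  case (Or \<phi> \<psi>)
  then show ?case
    using card_Un_le[of "loop_critical W R V \<phi>" "loop_critical W R V \<psi>"] by simp
next
  case (And \<phi> \<psi>)
  then show ?case
    using card_Un_le[of "loop_critical W R V \<phi>" "loop_critical W R V \<psi>"] by simp
next
  case (Dia \<phi>)
  let ?A = "{w \<in> W. sat W R V w \<phi>}"
  show ?case
    using Dia finite_card_singleton_eq[of ?A]
      card_Un_le[of "loop_critical W R V \<phi>" "{u. ?A = {u}}"] by simp
next
  case (Box \<phi>)
  let ?A = "{w \<in> W. \<not> sat W R V w \<phi>}"
  show ?case
    using Box finite_card_singleton_eq[of ?A]
      card_Un_le[of "loop_critical W R V \<phi>" "{u. ?A = {u}}"] by simp
qed simp_all

text \<open>Only \<open>u\<close> gains a successor, namely itself.\<close>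

lemma sat_add_loop:
  assumes "u \<in> W" "u \<notin> loop_critical W (complete_rel W) V \<phi>" "w \<in> W"
  shows "sat W (insert (u, u) (complete_rel W)) V w \<phi> \<longleftrightarrow> sat W (complete_rel W) V w \<phi>"
  using assms(2,3)
proof (induction \<phi> arbitrary: w)
  case (Dia \<phi>)
  have IH: "sat W (insert (u, u) (complete_rel W)) V v \<phi> \<longleftrightarrow> sat W (complete_rel W) V v \<phi>"
    if "v \<in> W" for v
    using Dia that by simp
  \<comment> \<open>As \<open>u\<close> is not critical, it is not the only witness. Any other
    witness is already a successor of \<open>u\<close> in the complete graph.\<close>
  have "\<exists>v\<in>W. v \<noteq> u \<and> sat W (complete_rel W) V v \<phi>" if "sat W (complete_rel W) V u \<phi>"
    using Dia.prems(1) that \<open>u \<in> W\<close> by auto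
  then show ?case
    using IH \<open>u \<in> W\<close> \<open>w \<in> W\<close> by (auto simp: complete_rel_def)
next
  case (Box \<phi>)
  have IH: "sat W (insert (u, u) (complete_rel W)) V v \<phi> \<longleftrightarrow> sat W (complete_rel W) V v \<phi>"
    if "v \<in> W" for v
    using Box that by simp
  have "\<exists>v\<in>W. v \<noteq> u \<and> \<not> sat W (complete_rel W) V v \<phi>" if "\<not> sat W (complete_rel W) V u \<phi>"
    using Box.prems(1) that \<open>u \<in> W\<close> by auto
  then show ?case
    using IH \<open>u \<in> W\<close> \<open>w \<in> W\<close> by (auto simp: complete_rel_def)
qed auto

text \<open>Two distinct vertices of a complete graph have the same successors, except that each
  sees the other; there the induction hypothesis applies.\<close>

lemma sat_complete_twins:
  assumes "u \<in> W" "v \<in> W" "V u \<inter> vars \<phi> = V v \<inter> vars \<phi>"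
  shows "sat W (complete_rel W) V u \<phi> \<longleftrightarrow> sat W (complete_rel W) V v \<phi>"
  using assms(3)
proof (induction \<phi>)
  case (Or \<phi> \<psi>)
  have "V u \<inter> vars \<phi> = V v \<inter> vars \<phi>" "V u \<inter> vars \<psi> = V v \<inter> vars \<psi>"
    using Or.prems by auto
  then show ?case using Or.IH by simp
next
  case (And \<phi> \<psi>)
  have "V u \<inter> vars \<phi> = V v \<inter> vars \<phi>" "V u \<inter> vars \<psi> = V v \<inter> vars \<psi>"
    using And.prems by auto
  then show ?case using And.IH by simp
next
  case (Dia \<phi>)
  then show ?case using assms(1,2) by (auto simp: complete_rel_def)
next
  case (Box \<phi>)
  then show ?case using assms(1,2) by (auto simp: complete_rel_def)
qed auto

text \<open>A truth set or falsity set equal to \<open>{u}\<close> would separate \<open>u\<close>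
  from \<open>v\<close>, contrary to \<open>sat_complete_twins\<close>.\<close>

lemma twin_not_loop_critical:
  assumes "u \<in> W" "v \<in> W" "u \<noteq> v" "V u \<inter> vars \<phi> = V v \<inter> vars \<phi>"
  shows "u \<notin> loop_critical W (complete_rel W) V \<phi>"
  using assms(4)
proof (induction \<phi>)
  case (Dia \<phi>)
  then show ?case
    using sat_complete_twins[OF assms(1,2), of V \<phi>] assms(1-3) by auto
next
  case (Box \<phi>)
  then show ?case
    using sat_complete_twins[OF assms(1,2), of V \<phi>] assms(1-3) by auto
qed (simp_all, blast+)

text \<open>Points of \<open>W\<close> have the same successors under \<open>R'\<close> as under
  \<open>R\<close>, all in \<open>W\<close>. Truth passes down only: \<open>Forall\<close> survives
  fewer points, whereas \<open>Exists\<close> could lose its witness.\<close>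

lemma sat_subgraph_no_exists:
  assumes "exists_count \<phi> = 0" "W \<subseteq> W'" "R \<subseteq> W \<times> W" "R' \<inter> W \<times> UNIV = R"
    and "w \<in> W" "sat W' R' V w \<phi>"
  shows "sat W R V w \<phi>"
  using assms(1,5,6)
proof (induction \<phi> arbitrary: w)
  case (Dia \<phi>)
  then obtain v where "(w, v) \<in> R'" "sat W' R' V v \<phi>" by auto
  then have "(w, v) \<in> R" "v \<in> W" using Dia.prems assms(3,4) by auto
  then show ?case using Dia \<open>sat W' R' V v \<phi>\<close> by auto
next
  case (Box \<phi>)
  then show ?case using assms(3,4) by auto
qed (use assms(2) in auto)

lemma loop_not_colourable: "(u, u) \<in> R \<Longrightarrow> \<not> colourable n W R"
  by (auto simp: colourable_def)

lemma complete_colourable: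
  assumes "finite W" "card W = n"
  shows "colourable n W (complete_rel W)"
proof -
  obtain c where "bij_betw c W {1..n}"
    using finite_same_card_bij[of W "{1..n}"] assms by auto
  then show ?thesis
    unfolding colourable_def complete_rel_def bij_betw_def inj_on_def by blast
qed

lemma finite_vars: "finite (vars \<phi>)"
  by (induction \<phi>) auto

lemma all_vertices_loop_critical:
  fixes \<phi> :: fm and W :: "'w set"
  assumes "defines_on_graphs \<phi> (\<lambda>(W :: 'w set) R. \<not> colourable n W R)"
    and "finite W" "card W = n" "W \<noteq> {}"
  obtains V where "W \<subseteq> loop_critical W (complete_rel W) V \<phi>"
proof -
  have "graph W (complete_rel W)"
    using \<open>W \<noteq> {}\<close> by (auto simp: graph_def frame_def complete_rel_def sym_def)
  then have "\<not> valid_on W (complete_rel W) \<phi>"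
    using assms complete_colourable[OF assms(2,3)] by (simp add: defines_on_graphs_def)
  then obtain V w where w: "w \<in> W" "\<not> sat W (complete_rel W) V w \<phi>"
    by (auto simp: valid_on_def)
  \<comment> \<open>The refuting \<open>V\<close> and \<open>w\<close> are fixed before
    \<open>u\<close>, so one valuation serves all vertices.\<close>
  have "u \<in> loop_critical W (complete_rel W) V \<phi>" if "u \<in> W" for u
  proof (rule ccontr)
    assume non_critical: "u \<notin> loop_critical W (complete_rel W) V \<phi>"
    let ?R = "insert (u, u) (complete_rel W)"
    have "graph W ?R"
      using \<open>u \<in> W\<close> by (auto simp: graph_def frame_def complete_rel_def sym_def)
    then have "valid_on W ?R \<phi>"
      using assms(1) loop_not_colourable[of u ?R] by (simp add: defines_on_graphs_def)
    then show False
      using w sat_add_loop[OF \<open>u \<in> W\<close> non_critical \<open>w \<in> W\<close>] by (auto simp: valid_on_def)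
  qed
  then show thesis using that by blast
qed

text \<open>The looped point \<open>b\<close> spoils colourability, yet \<open>a\<close> has no
  successors with or without it.\<close>

lemma exists_count_pos:
  fixes \<phi> :: fm and a b :: 'w
  assumes "a \<noteq> b" "n \<ge> 1"
    and "defines_on_graphs \<phi> (\<lambda>(W :: 'w set) R. \<not> colourable n W R)"
  shows "exists_count \<phi> \<ge> 1"
proof (rule ccontr)
  assume "\<not> exists_count \<phi> \<ge> 1"
  then have no_exists: "exists_count \<phi> = 0" by simp
  have "graph {a, b} {(b, b)}" by (auto simp: graph_def frame_def sym_def)
  then have "valid_on {a, b} {(b, b)} \<phi>"
    using assms(3) loop_not_colourable[of b "{(b, b)}"] by (simp add: defines_on_graphs_def)
  then have "valid_on {a} {} \<phi>"
    using sat_subgraph_no_exists[OF no_exists, of "{a}" "{a, b}" "{}" "{(b, b)}" a] \<open>a \<noteq> b\<close>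
    by (auto simp: valid_on_def)
  moreover have "graph {a} {}" by (auto simp: graph_def frame_def sym_def)
  moreover have "colourable n {a} {}"
    using \<open>n \<ge> 1\<close> by (auto simp: colourable_def intro!: exI[of _ "\<lambda>_. 1"])
  ultimately show False
    using assms(3) by (simp add: defines_on_graphs_def)
qed

theorem theorem5p3:
  fixes n :: nat and \<phi> :: fm
  assumes "infinite (UNIV :: 'w set)"
    and "n \<ge> 2"
    and "defines_on_graphs \<phi> (\<lambda>(W :: 'w set) R. \<not> colourable n W R)"
  shows "\<lceil>log 2 (real n)\<rceil> \<le> int (card (vars \<phi>))
    \<and> exists_count \<phi> \<ge> 1
    \<and> fm_length \<phi> \<ge> n"
proof -
  obtain W :: "'w set" where W: "finite W" "card W = n"
    using infinite_arbitrarily_large[OF assms(1)] by blast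
  moreover from W have "W \<noteq> {}" using \<open>n \<ge> 2\<close> by auto
  ultimately obtain V where V: "W \<subseteq> loop_critical W (complete_rel W) V \<phi>"
    using all_vertices_loop_critical[OF assms(3)] by blast

  \<comment> \<open>Distinct vertices agreeing on \<open>vars \<phi>\<close> would be twins, hence
    not critical.\<close>
  have "inj_on (\<lambda>w. V w \<inter> vars \<phi>) W"
    using V twin_not_loop_critical[of _ W _ V \<phi>] by (intro inj_onI) blast
  then have "card W \<le> card (Pow (vars \<phi>))"
    by (intro card_inj_on_le[where f = "\<lambda>w. V w \<inter> vars \<phi>"]) (auto simp: finite_vars)
  then have "real n \<le> 2 ^ card (vars \<phi>)"
    using W by (simp add: card_Pow finite_vars)
  then have "log 2 (real n) \<le> real (card (vars \<phi>))"
    using \<open>n \<ge> 2\<close> by (simp add: log_le_iff powr_realpow)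
  then have "\<lceil>log 2 (real n)\<rceil> \<le> int (card (vars \<phi>))"
    by (simp add: ceiling_le_iff)
  moreover have "fm_length \<phi> \<ge> n"
    using finite_card_loop_critical[of W "complete_rel W" V \<phi>] card_mono[OF _ V] W by simp
  moreover have "exists_count \<phi> \<ge> 1"
  proof -
    \<comment> \<open>Here \<open>undefined\<close> is merely some element of \<open>'w\<close>; two
      distinct points are needed.\<close>
    obtain b :: 'w where "b \<notin> {undefined}"
      using ex_new_if_finite[OF assms(1), of "{undefined}"] by blast
    then have "b \<noteq> undefined" by simp
    then show ?thesis using exists_count_pos[OF _ _ assms(3)] \<open>n \<ge> 2\<close> by simp
  qed
  ultimately show ?thesis by blast
qed

end
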